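(* Every reflexive Banach space with a $\mathcal{D}$-unconditional Schauder basis satisfying $\mathcal{D}<\sqrt{6}-1$ has the fixed point property.
   Context: A Schauder basis $(e_n)$ of $X$ is $\mathcal{D}$-unconditional if it is unconditional (every expansion $x=\sum_na_ne_n$ converges unconditionally) and $\big\|\sum_n\epsilon_na_ne_n\big\|\le\mathcal{D}\big\|\sum_na_ne_n\big\|$ for every $x=\sum_na_ne_n\in X$ and every choice of signs $(\epsilon_n)\in\{-1,1\}^{\mathbb{N}}$. A mapping $T\colon C\to C$ on a subset $C$ of $X$ is nonexpansive if $\|Tx-Ty\|\le\|x-y\|$ for all $x,y\in C$. A Banach space $X$ has the fixed point property if for every nonempty bounded closed convex subset $C$ of $X$, every nonexpansive mapping $T\colon C\to C$ has a fixed point. *)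

theory Defs
  imports "HOL-Analysis.Analysis"
begin

text \<open>Banach spaces are real and are represented by types of class \<open>banach\<close>.\<close>

lift_definition bidual_embedding ::
  "'a::real_normed_vector \<Rightarrow> (('a \<Rightarrow>\<^sub>L real) \<Rightarrow>\<^sub>L real)"
  is "\<lambda>x f. blinfun_apply f x"
  by (rule blinfun.bounded_linear_left)

definition reflexive_space :: "'a::real_normed_vector itself \<Rightarrow> bool" where
  "reflexive_space _ \<longleftrightarrow> surj (bidual_embedding :: 'a \<Rightarrow> _)"

definition schauder_basis :: "(nat \<Rightarrow> 'a::real_normed_vector) \<Rightarrow> bool" where
  "schauder_basis e \<longleftrightarrow> (\<forall>x. \<exists>!a :: nat \<Rightarrow> real. (\<lambda>n. a n *\<^sub>R e n) sums x)"

definition unconditionally_convergent :: "(nat \<Rightarrow> 'a::real_normed_vector) \<Rightarrow> bool" where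
  "unconditionally_convergent u \<longleftrightarrow> (\<forall>\<pi>. bij \<pi> \<longrightarrow> summable (\<lambda>n. u (\<pi> n)))"

definition unconditional_basis :: "(nat \<Rightarrow> 'a::real_normed_vector) \<Rightarrow> bool" where
  "unconditional_basis e \<longleftrightarrow> schauder_basis e \<and>
     (\<forall>a :: nat \<Rightarrow> real. summable (\<lambda>n. a n *\<^sub>R e n) \<longrightarrow>
        unconditionally_convergent (\<lambda>n. a n *\<^sub>R e n))"

text \<open>In a Banach space, unconditional convergence of an expansion makes all of its signed series
  converge, so the left-hand \<open>suminf\<close> below is a genuine sum.\<close>

definition D_unconditional_basis :: "real \<Rightarrow> (nat \<Rightarrow> 'a::real_normed_vector) \<Rightarrow> bool" where
  "D_unconditional_basis D e \<longleftrightarrow> unconditional_basis e \<and>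
     (\<forall>(a :: nat \<Rightarrow> real) (\<epsilon> :: nat \<Rightarrow> real).
        summable (\<lambda>n. a n *\<^sub>R e n) \<longrightarrow> range \<epsilon> \<subseteq> {-1, 1} \<longrightarrow>
        norm (\<Sum>n. \<epsilon> n *\<^sub>R a n *\<^sub>R e n) \<le> D * norm (\<Sum>n. a n *\<^sub>R e n))"

definition nonexpansive_on :: "'a::real_normed_vector set \<Rightarrow> ('a \<Rightarrow> 'a) \<Rightarrow> bool" where
  "nonexpansive_on C T \<longleftrightarrow> (\<forall>x\<in>C. \<forall>y\<in>C. norm (T x - T y) \<le> norm (x - y))"

definition fixed_point_property :: "'a::real_normed_vector itself \<Rightarrow> bool" where
  "fixed_point_property _ \<longleftrightarrow>
     (\<forall>(C :: 'a set) T. C \<noteq> {} \<longrightarrow> bounded C \<longrightarrow> closed C \<longrightarrow> convex C \<longrightarrow>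
        T \<in> C \<rightarrow> C \<longrightarrow> nonexpansive_on C T \<longrightarrow> (\<exists>x\<in>C. T x = x))"

end

theory Submission
  imports Defs
begin

text \<open>
  A minimal nonempty closed convex invariant set \<open>K\<close> of a nonexpansive map \<open>T\<close> exists by weak compactness,
  and it must be shown that its diameter \<open>d\<close> is \<open>0\<close>. By the lemma of Goebel and Karlovitz every almost
  fixed point of \<open>T\<close> in \<open>K\<close> has distance almost \<open>d\<close> from any prescribed point \<open>p\<close> of \<open>K\<close>. The idea,
  going back to P.-K. Lin, is to build an almost fixed point \<open>w\<close> that is close to three points which
  the basis separates from one another, and to deduce that \<open>w\<close> is too close to \<open>p\<close>.

  Let \<open>x\<^sub>n\<close> be almost fixed points converging weakly to \<open>p\<close>, and let \<open>x = x\<^sub>m\<close> and \<open>y = x\<^sub>n\<close> with \<open>n\<close> much larger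
  than \<open>m\<close>, so that \<open>x - p\<close> and \<open>y - p\<close> are almost disjointly supported. The resolvent \<open>R\<close> of \<open>T\<close> sends
  points of \<open>K\<close> to almost fixed points, does not increase distances, and almost fixes \<open>x\<close> and \<open>y\<close>. Put
  \<open>w = R ((x + y) / 2)\<close> and \<open>z = R p\<close>. Up to small errors \<open>w\<close> has distance at most \<open>d / 2\<close>
  from \<open>x\<close> and from \<open>y\<close>, and distance at most \<open>\<parallel>(x + y) / 2 - p\<parallel> \<le> D d / 2\<close> from \<open>z\<close>, since a change of
  signs turns \<open>x - y\<close> into \<open>(x - p) + (y - p)\<close>.

  With \<open>E N\<close> the partial sum projections, \<open>M\<close> past the support of \<open>z - p\<close>, and \<open>N\<close> past that of \<open>x - p\<close>,
  \<open>2 (w - p) = E N (w - p) + (1 - E N + E M) (w - p) + (1 - E M) (w - p)\<close>.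
  The second operator annihilates \<open>x - p\<close>, the third annihilates \<open>z - p\<close>, and both have norm at most
  \<open>(1 + D) / 2\<close>; these terms contribute \<open>(1 + D) / 2 \<cdot> d / 2\<close> and \<open>(1 + D) / 2 \<cdot> D d / 2\<close>. The first
  term is at most \<open>d / 2\<close>, with no factor \<open>(1 + D) / 2\<close>: as \<open>y\<close> moves out, \<open>w\<close> has a weak limit \<open>w\<^sub>0\<close>, lower
  semicontinuity gives \<open>\<parallel>w\<^sub>0 - p\<parallel> \<le> liminf \<parallel>w - y\<parallel> \<le> d / 2\<close>, and if \<open>N\<close> is also past the support of
  \<open>w\<^sub>0 - p\<close>, then \<open>E N (w - p)\<close> is close to \<open>w\<^sub>0 - p\<close>. Since \<open>\<parallel>w - p\<parallel>\<close> is almost \<open>d\<close>, altogether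
  \<open>2 d \<le> (1 / 2 + (1 + D)\<^sup>2 / 4) d\<close>, which forces \<open>d = 0\<close> when \<open>(1 + D)\<^sup>2 < 6\<close>.

  The carrying lemmas are \<open>weak_cluster_point\<close>, \<open>goebel_karlovitz\<close>, the
  resolvent lemmas, \<open>norm_le_of_three_close_points\<close> and \<open>diameter_minimal_invariant_bound\<close>.
\<close>

section \<open>Sublinear functionals and separation\<close>

definition sublinear :: "('a::real_vector \<Rightarrow> real) \<Rightarrow> bool" where
  "sublinear p \<longleftrightarrow>
     (\<forall>x y. p (x + y) \<le> p x + p y) \<and> (\<forall>t x. 0 \<le> t \<longrightarrow> p (t *\<^sub>R x) = t * p x)"

lemma sublinear_zero: "sublinear p \<Longrightarrow> p 0 = 0"
  unfolding sublinear_def by (metis mult_zero_left order_refl scale_zero_left)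

lemma sublinear_ge_minus:
  assumes "sublinear p" shows "- p (- x) \<le> p x"
proof -
  have "p (x + - x) \<le> p x + p (- x)"
    using assms unfolding sublinear_def by blast
  then show ?thesis
    using sublinear_zero[OF assms] by simp
qed

text \<open>The infimum of \<open>p (y + t c) - t d\<close> over \<open>t \<ge> 0\<close> and \<open>c \<in> C\<close> is the largest sublinear functional below
  \<open>p\<close> that is at most \<open>- d\<close> on \<open>- C\<close>. It serves twice: a singleton \<open>C\<close> shows that a minimal
  sublinear functional is odd, and a translate of a convex set away from \<open>0\<close>, with \<open>p\<close> the norm,
  gives a separating functional.\<close>

lemma sublinear_decrease_along_convex:
  fixes p :: "'a::real_vector \<Rightarrow> real"
  assumes p: "sublinear p" and C: "convex C" "C \<noteq> {}" and d: "\<And>c. c \<in> C \<Longrightarrow> d \<le> p c"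
  shows "\<exists>q. sublinear q \<and> (\<forall>y. q y \<le> p y) \<and> (\<forall>c\<in>C. q (- c) \<le> - d)"
proof -
  have add: "p (x + y) \<le> p x + p y" for x y
    using p unfolding sublinear_def by blast
  have scale: "p (t *\<^sub>R x) = t * p x" if "0 \<le> t" for t x
    using p that unfolding sublinear_def by blast
  define S where "S y = {p (y + t *\<^sub>R c) - t * d | t c. 0 \<le> t \<and> c \<in> C}" for y
  define q where "q y = Inf (S y)" for y
  have lower: "- p (- y) \<le> v" if v: "v \<in> S y" for v y
  proof -
    obtain t c where tc: "0 \<le> t" "c \<in> C" "v = p (y + t *\<^sub>R c) - t * d"
      using v unfolding S_def by blast
    have "t * d \<le> p (t *\<^sub>R c)"
      using d[OF tc(2)] tc(1) scale[OF tc(1)] by (simp add: mult_left_mono)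
    also have "\<dots> \<le> p (y + t *\<^sub>R c) + p (- y)"
      using add[of "y + t *\<^sub>R c" "- y"] by simp
    finally show ?thesis
      using tc(3) by simp
  qed
  have q_le: "q y \<le> v" if "v \<in> S y" for v y
    unfolding q_def using that lower by (intro cInf_lower bdd_belowI) auto
  have S_ne: "S y \<noteq> {}" for y
    unfolding S_def using C(2) by auto
  have q_ge: "l \<le> q y" if "\<And>v. v \<in> S y \<Longrightarrow> l \<le> v" for l y
    unfolding q_def using that S_ne by (intro cInf_greatest) auto
  have q_scale_le: "q (s *\<^sub>R y) \<le> s * q y" if s: "0 < s" for s y
  proof -
    have "q (s *\<^sub>R y) / s \<le> q y"
    proof (rule q_ge)
      fix v assume "v \<in> S y"
      then obtain t c where tc: "0 \<le> t" "c \<in> C" "v = p (y + t *\<^sub>R c) - t * d"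
        unfolding S_def by blast
      have "s * v = p (s *\<^sub>R y + (s * t) *\<^sub>R c) - (s * t) * d"
        using scale[of s "y + t *\<^sub>R c"] s unfolding tc(3)
        by (simp add: scaleR_right_distrib right_diff_distrib mult.assoc)
      then have "s * v \<in> S (s *\<^sub>R y)"
        unfolding S_def using tc(1,2) s by (auto intro!: exI[of _ "s * t"] exI[of _ c])
      then show "q (s *\<^sub>R y) / s \<le> v"
        using q_le[of "s * v"] s by (simp add: divide_le_eq mult.commute)
    qed
    then show ?thesis
      using s by (simp add: divide_le_eq mult.commute)
  qed
  have q_scale_pos: "q (s *\<^sub>R y) = s * q y" if s: "0 < s" for s y
  proof (rule antisym[OF q_scale_le[OF s]])
    have "q ((1 / s) *\<^sub>R (s *\<^sub>R y)) \<le> (1 / s) * q (s *\<^sub>R y)"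
      using s by (intro q_scale_le) simp
    then show "s * q y \<le> q (s *\<^sub>R y)"
      using s by (simp add: field_simps)
  qed
  have q_le_p: "q y \<le> p y" for y
  proof -
    obtain c where "c \<in> C" using C(2) by blast
    then have "p y \<in> S y"
      unfolding S_def by (auto intro!: exI[of _ 0] exI[of _ c])
    then show ?thesis by (rule q_le)
  qed
  have q0: "q 0 = 0"
    using q_le_p[of 0] q_ge[of 0 0] lower[of _ 0] sublinear_zero[OF p]
    by (intro antisym) auto
  have q_add: "q (x + y) \<le> q x + q y" for x y
  proof -
    have *: "q (x + y) \<le> u + v" if uv: "u \<in> S x" "v \<in> S y" for u v
    proof -
      obtain t c where tc: "0 \<le> t" "c \<in> C" "u = p (x + t *\<^sub>R c) - t * d"
        using uv(1) unfolding S_def by blast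
      obtain t' c' where tc': "0 \<le> t'" "c' \<in> C" "v = p (y + t' *\<^sub>R c') - t' * d"
        using uv(2) unfolding S_def by blast
      \<comment> \<open>convexity of \<open>C\<close> merges the two rays into one\<close>
      obtain c'' where c'': "c'' \<in> C" "(t + t') *\<^sub>R c'' = t *\<^sub>R c + t' *\<^sub>R c'"
      proof (cases "t + t' = 0")
        case True
        then have "t = 0" "t' = 0" using tc tc' by auto
        then show ?thesis using that tc(2) by simp
      next
        case False
        let ?c = "(t / (t + t')) *\<^sub>R c + (t' / (t + t')) *\<^sub>R c'"
        have "?c \<in> C"
          using C(1) tc tc' False
          by (intro convexD) (simp_all add: add_divide_distrib[symmetric])
        moreover have "(t + t') *\<^sub>R ?c = t *\<^sub>R c + t' *\<^sub>R c'"
          using False by (simp add: scaleR_right_distrib)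
        ultimately show ?thesis using that by blast
      qed
      have "p (x + y + (t + t') *\<^sub>R c'') - (t + t') * d \<in> S (x + y)"
        unfolding S_def using tc tc' c''(1) by (auto intro!: exI[of _ "t + t'"] exI[of _ c''])
      then have "q (x + y) \<le> p ((x + t *\<^sub>R c) + (y + t' *\<^sub>R c')) - (t + t') * d"
        using q_le[of _ "x + y"] c''(2) by (simp add: add_ac)
      also have "\<dots> \<le> u + v"
        using add[of "x + t *\<^sub>R c" "y + t' *\<^sub>R c'"] tc(3) tc'(3) by (simp add: algebra_simps)
      finally show ?thesis .
    qed
    have "q (x + y) - v \<le> q x" if "v \<in> S y" for v
      using * that by (intro q_ge) (auto simp: diff_le_eq)
    then have "q (x + y) - q x \<le> q y"
      by (intro q_ge) (auto simp: diff_le_eq add.commute)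
    then show ?thesis by simp
  qed
  have "sublinear q"
    unfolding sublinear_def
  proof (intro conjI allI impI)
    fix t :: real and x assume "0 \<le> t"
    then show "q (t *\<^sub>R x) = t * q x"
      using q_scale_pos[of t x] q0 by (cases "t = 0") auto
  qed (rule q_add)
  moreover have "q (- c) \<le> - d" if "c \<in> C" for c
  proof (rule q_le)
    show "- d \<in> S (- c)"
      unfolding S_def using that sublinear_zero[OF p]
      by (auto intro!: exI[of _ 1] exI[of _ c])
  qed
  ultimately show ?thesis
    using q_le_p by blast
qed

text \<open>The Hahn-Banach theorem. Zorn's lemma yields a minimal sublinear functional \<open>m\<close> below \<open>p\<close>. It cannot be
  decreased along any single vector \<open>x\<close>, which forces \<open>m (- x) \<le> - m x\<close>, and an odd sublinear
  functional is linear.\<close>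

lemma linear_below_sublinear:
  fixes p :: "'a::real_vector \<Rightarrow> real"
  assumes p: "sublinear p"
  shows "\<exists>f. linear f \<and> (\<forall>x. f x \<le> p x)"
proof -
  define A where "A = {q. sublinear q \<and> (\<forall>x. q x \<le> p x)}"
  have po: "partial_order_on A (relation_of (\<lambda>q r. r \<le> q) A)"
    by (rule partial_order_on_relation_ofI) auto
  have "\<exists>m\<in>A. \<forall>q\<in>A. q \<le> m \<longrightarrow> q = m"
  proof (rule predicate_Zorn[OF po])
    fix Q assume Q: "Q \<in> Chains (relation_of (\<lambda>q r. r \<le> q) A)"
    have QA: "Q \<subseteq> A" by (rule Chains_relation_of[OF Q])
    have total: "q \<le> r \<or> r \<le> q" if "q \<in> Q" "r \<in> Q" for q r
      using Q that unfolding Chains_def relation_of_def by auto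
    show "\<exists>u\<in>A. \<forall>q\<in>Q. u \<le> q"
    proof (cases "Q = {}")
      case True
      then show ?thesis using p unfolding A_def by auto
    next
      case False
      define u where "u x = Inf ((\<lambda>q. q x) ` Q)" for x
      have sub: "sublinear q" "q x \<le> p x" if "q \<in> Q" for q x
        using QA that unfolding A_def by auto
      have "- p (- x) \<le> q x" if "q \<in> Q" for q x
        using sublinear_ge_minus[OF sub(1)[OF that], of x] sub(2)[OF that, of "- x"] by linarith
      then have u_le: "u x \<le> q x" if "q \<in> Q" for q x
        unfolding u_def using that by (intro cInf_lower bdd_belowI[of _ "- p (- x)"]) auto
      have u_ge: "l \<le> u x" if "\<And>q. q \<in> Q \<Longrightarrow> l \<le> q x" for l x
        unfolding u_def using that False by (intro cInf_greatest) auto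
      have "sublinear u"
        unfolding sublinear_def
      proof (intro conjI allI impI)
        fix x y
        have *: "u (x + y) \<le> q x + r y" if qr: "q \<in> Q" "r \<in> Q" for q r
        proof -
          obtain s where s: "s \<in> Q" "s \<le> q" "s \<le> r"
            using total[OF qr] qr by blast
          have "u (x + y) \<le> s x + s y"
            using u_le[OF s(1), of "x + y"] sub(1)[OF s(1)] unfolding sublinear_def
            by (meson order_trans)
          also have "\<dots> \<le> q x + r y"
            using s(2,3) by (intro add_mono) (auto simp: le_fun_def)
          finally show ?thesis .
        qed
        have "u (x + y) - r y \<le> u x" if "r \<in> Q" for r
          using * that by (intro u_ge) (auto simp: diff_le_eq)
        then have "u (x + y) - u x \<le> u y"
          by (intro u_ge) (auto simp: diff_le_eq add.commute)
        then show "u (x + y) \<le> u x + u y" by simp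
      next
        fix t :: real and x assume t: "0 \<le> t"
        have q: "q (t *\<^sub>R x) = t * q x" if "q \<in> Q" for q
          using sub(1)[OF that] t unfolding sublinear_def by blast
        show "u (t *\<^sub>R x) = t * u x"
        proof (cases "t = 0")
          case True
          have "(\<lambda>q. q 0) ` Q = {0}"
            using \<open>Q \<noteq> {}\<close> sublinear_zero[OF sub(1)] by (auto simp: image_iff)
          then show ?thesis using True by (simp add: u_def)
        next
          case False
          then have t: "0 < t" using t by simp
          have "u (t *\<^sub>R x) / t \<le> u x"
            using u_le q t by (intro u_ge) (metis divide_le_eq mult.commute)
          moreover have "t * u x \<le> u (t *\<^sub>R x)"
            using u_le t by (intro u_ge) (simp add: q mult_left_mono)
          ultimately show ?thesis using t by (simp add: divide_le_eq mult.commute)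
        qed
      qed
      moreover have "u x \<le> p x" for x
        using False u_le sub(2) by (meson all_not_in_conv order_trans)
      ultimately show ?thesis
        unfolding A_def using u_le by (auto simp: le_fun_def)
    qed
  qed
  then obtain m where m: "sublinear m" "\<And>x. m x \<le> p x"
    and minimal: "\<And>q. q \<in> A \<Longrightarrow> q \<le> m \<Longrightarrow> q = m"
    unfolding A_def by blast
  have le_minus: "m (- x) \<le> - m x" for x
  proof -
    obtain q where q: "sublinear q" "\<And>y. q y \<le> m y" "q (- x) \<le> - m x"
      using sublinear_decrease_along_convex[OF m(1), of "{x}" "m x"] by auto
    then have "q = m"
      using m(2) by (intro minimal) (auto simp: A_def le_fun_def intro: order_trans)
    then show ?thesis using q(3) by simp
  qed
  have odd: "m (- x) = - m x" for x
    using le_minus[of x] sublinear_ge_minus[OF m(1), of x] by simp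
  have add: "m (x + y) = m x + m y" for x y
  proof (rule antisym)
    have sub: "m (a + b) \<le> m a + m b" for a b
      using m(1) unfolding sublinear_def by blast
    show "m (x + y) \<le> m x + m y" by (rule sub)
    have "m (- (x + y)) \<le> m (- x) + m (- y)"
      using sub[of "- x" "- y"] by (simp add: add.commute)
    then show "m x + m y \<le> m (x + y)" unfolding odd by simp
  qed
  have "linear m"
  proof (rule linearI)
    fix t :: real and x
    have pos: "m (s *\<^sub>R x) = s * m x" if "0 \<le> s" for s
      using m(1) that unfolding sublinear_def by blast
    show "m (t *\<^sub>R x) = t *\<^sub>R m x"
      using pos[of t] pos[of "- t"] odd[of "t *\<^sub>R x"] by (cases "0 \<le> t") auto
  qed (rule add)
  then show ?thesis using m(2) by blast
qed

text \<open>Decreasing the norm along \<open>C - x\<close>, which stays at distance \<open>d\<close> from \<open>0\<close>, leaves a sublinear functional;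
  any linear functional below it is bounded by the norm and is at least \<open>d\<close> on \<open>C - x\<close>.\<close>

lemma closed_convex_point_separation:
  fixes C :: "'a::real_normed_vector set"
  assumes C: "convex C" "closed C" "C \<noteq> {}" and x: "x \<notin> C"
  shows "\<exists>(f :: 'a \<Rightarrow>\<^sub>L real) d. 0 < d \<and> (\<forall>c\<in>C. f x + d \<le> f c)"
proof -
  obtain d where d: "0 < d" "\<And>c. c \<in> C \<Longrightarrow> d \<le> dist x c"
  proof -
    obtain d where "0 < d" "ball x d \<subseteq> - C"
      using C(2) x unfolding closed_def open_contains_ball by blast
    then show ?thesis
      using that[of d] by (meson ComplD mem_ball not_less subsetD)
  qed
  let ?C = "(\<lambda>c. c - x) ` C"
  have norm: "sublinear (norm :: 'a \<Rightarrow> real)"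
    unfolding sublinear_def by (simp add: norm_triangle_ineq)
  have "convex ?C" "?C \<noteq> {}"
    using C(1,3) convex_translation_subtract by auto
  moreover have "d \<le> norm c" if "c \<in> ?C" for c
    using d(2) that by (auto simp: dist_norm norm_minus_commute)
  ultimately obtain q where q: "sublinear q" "\<And>y. q y \<le> norm y" "\<And>c. c \<in> C \<Longrightarrow> q (- (c - x)) \<le> - d"
    using sublinear_decrease_along_convex[OF norm, of ?C d] by auto
  obtain f where f: "linear f" "\<And>y. f y \<le> q y"
    using linear_below_sublinear[OF q(1)] by blast
  have f_le: "f y \<le> norm y" for y
    using f(2) q(2) order_trans by blast
  have "norm (f y) \<le> norm y * 1" for y
    using f_le[of y] f_le[of "- y"] linear_neg[OF f(1)] by auto
  then have "bounded_linear f"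
    using f(1) by (intro bounded_linear_intro[where K = 1]) (auto simp: linear_add linear_cmul)
  then have F: "blinfun_apply (Blinfun f) = f"
    by (rule bounded_linear_Blinfun_apply)
  have "f x + d \<le> f c" if "c \<in> C" for c
  proof -
    have "f (- (c - x)) \<le> - d"
      using f(2) q(3)[OF that] order_trans by blast
    then show ?thesis
      using f(1) by (simp add: linear_diff linear_neg)
  qed
  then show ?thesis
    using d(1) F by metis
qed

section \<open>Weak limits in reflexive spaces\<close>

text \<open>Arbitrary filters are allowed because passing to a finer filter plays the part of passing to a
  weakly convergent subsequence.\<close>

definition weakly_tendsto :: "('i \<Rightarrow> 'a::real_normed_vector) \<Rightarrow> 'a \<Rightarrow> 'i filter \<Rightarrow> bool" where
  "weakly_tendsto g x F \<longleftrightarrow> (\<forall>f :: 'a \<Rightarrow>\<^sub>L real. ((\<lambda>i. f (g i)) \<longlongrightarrow> f x) F)"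

lemma weakly_tendsto_mono: "weakly_tendsto g x F \<Longrightarrow> F' \<le> F \<Longrightarrow> weakly_tendsto g x F'"
  unfolding weakly_tendsto_def using tendsto_mono by blast

lemma weakly_tendsto_diff:
  "weakly_tendsto g x F \<Longrightarrow> weakly_tendsto h y F \<Longrightarrow> weakly_tendsto (\<lambda>i. g i - h i) (x - y) F"
  unfolding weakly_tendsto_def by (auto simp: blinfun.diff_right intro: tendsto_diff)

text \<open>Mazur's theorem. Applied to closed balls it also says that the norm is weakly lower semicontinuous,
  and this is how norms of weak limits are estimated below.\<close>

lemma weak_limit_in_closed_convex:
  fixes x :: "'a::real_normed_vector"
  assumes g: "weakly_tendsto g x F" and F: "F \<noteq> bot"
    and C: "convex C" "closed C" and ev: "eventually (\<lambda>i. g i \<in> C) F"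
  shows "x \<in> C"
proof (rule ccontr)
  assume x: "x \<notin> C"
  have "C \<noteq> {}"
    using ev F by (auto simp: trivial_limit_def)
  then obtain f :: "'a \<Rightarrow>\<^sub>L real" and d where f: "0 < d" "\<And>c. c \<in> C \<Longrightarrow> f x + d \<le> f c"
    using closed_convex_point_separation[OF C _ x] by blast
  have "((\<lambda>i. f (g i)) \<longlongrightarrow> f x) F"
    using g unfolding weakly_tendsto_def by blast
  moreover have "eventually (\<lambda>i. f x + d \<le> f (g i)) F"
    using ev by eventually_elim (rule f(2))
  ultimately have "f x + d \<le> f x"
    using F tendsto_lowerbound by blast
  then show False using f(1) by simp
qed

text \<open>Weak compactness of balls. Evaluation maps the points \<open>g i\<close> into a product of compact intervals
  indexed by the dual space, so Tychonoff's theorem provides a pointwise cluster point \<open>\<Phi>\<close>. It is a bounded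
  linear functional on the dual, and reflexivity represents it by a vector.\<close>

lemma weak_cluster_point:
  fixes g :: "'i \<Rightarrow> 'a::real_normed_vector"
  assumes refl: "reflexive_space TYPE('a)" and F: "F \<noteq> bot" and M: "\<And>i. norm (g i) \<le> M"
  shows "\<exists>U x. U \<noteq> bot \<and> U \<le> F \<and> weakly_tendsto g x U"
proof -
  define P where "P = PiE UNIV (\<lambda>f :: 'a \<Rightarrow>\<^sub>L real. {- norm f * M .. norm f * M})"
  define G where "G i = (\<lambda>f :: 'a \<Rightarrow>\<^sub>L real. f (g i))" for i
  have G_bound: "\<bar>G i f\<bar> \<le> norm f * M" for i f
    using norm_blinfun[of f "g i"] mult_left_mono[OF M[of i] norm_ge_zero[of f]]
    unfolding G_def by simp
  have "compactin (product_topology (\<lambda>_. euclidean) UNIV) P"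
    unfolding P_def compactin_PiE by auto
  then have "compact P"
    unfolding euclidean_product_topology by simp
  moreover have "filtermap G F \<noteq> bot"
    using F by (simp add: filtermap_bot_iff)
  moreover have "eventually (\<lambda>h. h \<in> P) (filtermap G F)"
    unfolding eventually_filtermap P_def using G_bound
    by (auto simp: abs_le_iff intro!: always_eventually) (metis minus_le_iff)+
  ultimately obtain \<Phi> where \<Phi>: "\<Phi> \<in> P" "inf (nhds \<Phi>) (filtermap G F) \<noteq> bot"
    unfolding compact_filter by blast
  define U where "U = inf F (filtercomap G (nhds \<Phi>))"
  \<comment> \<open>\<open>U\<close> is proper because \<open>\<Phi>\<close> is a cluster point of \<open>G\<close> along \<open>F\<close>\<close>
  have U_bot: "U \<noteq> bot"
  proof
    assume "U = bot"
    then obtain Q where Q: "eventually Q F" "eventually (\<lambda>i. Q i \<longrightarrow> False) (filtercomap G (nhds \<Phi>))"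
      unfolding U_def trivial_limit_def eventually_inf by (metis (mono_tags, lifting) eventually_mono)
    then obtain R where R: "eventually R (nhds \<Phi>)" "\<And>i. R (G i) \<Longrightarrow> \<not> Q i"
      unfolding eventually_filtercomap by blast
    have "eventually (\<lambda>h. \<not> R h) (filtermap G F)"
      unfolding eventually_filtermap using Q(1) by eventually_elim (use R(2) in blast)
    then have "inf (nhds \<Phi>) (filtermap G F) = bot"
      unfolding trivial_limit_def eventually_inf using R(1) by blast
    then show False using \<Phi>(2) by blast
  qed
  have G_lim: "(G \<longlongrightarrow> \<Phi>) U"
    unfolding U_def filterlim_iff_le_filtercomap by simp
  have lim: "((\<lambda>i. blinfun_apply f (g i)) \<longlongrightarrow> \<Phi> f) U" for f :: "'a \<Rightarrow>\<^sub>L real"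
  proof (rule topological_tendstoI)
    fix S :: "real set" assume S: "open S" "\<Phi> f \<in> S"
    have "open ((\<lambda>\<Psi> :: ('a \<Rightarrow>\<^sub>L real) \<Rightarrow> real. \<Psi> f) -` S)"
      by (rule open_vimage[OF S(1)]) simp
    from topological_tendstoD[OF G_lim this] show "eventually (\<lambda>i. f (g i) \<in> S) U"
      using S(2) unfolding G_def by simp
  qed
  have "bounded_linear \<Phi>"
  proof (rule bounded_linear_intro[where K = M])
    fix f h :: "'a \<Rightarrow>\<^sub>L real" and r :: real
    have "((\<lambda>i. (f + h) (g i)) \<longlongrightarrow> \<Phi> f + \<Phi> h) U"
      using tendsto_add[OF lim[of f] lim[of h]] by (simp add: plus_blinfun.rep_eq)
    then show "\<Phi> (f + h) = \<Phi> f + \<Phi> h"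
      using tendsto_unique[OF U_bot lim] by blast
    have "((\<lambda>i. (r *\<^sub>R f) (g i)) \<longlongrightarrow> r *\<^sub>R \<Phi> f) U"
      using tendsto_scaleR[OF tendsto_const lim[of f]] by (simp add: scaleR_blinfun.rep_eq)
    then show "\<Phi> (r *\<^sub>R f) = r *\<^sub>R \<Phi> f"
      using tendsto_unique[OF U_bot lim] by blast
    show "norm (\<Phi> f) \<le> norm f * M"
      using \<Phi>(1) unfolding P_def by (auto simp: PiE_iff abs_le_iff) (metis minus_le_iff)
  qed
  then have "blinfun_apply (Blinfun \<Phi>) = \<Phi>"
    by (rule bounded_linear_Blinfun_apply)
  moreover obtain x where "Blinfun \<Phi> = bidual_embedding x"
    using refl unfolding reflexive_space_def by (metis surjD)
  ultimately have "\<Phi> f = f x" for f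
    by (metis bidual_embedding.rep_eq)
  then have "weakly_tendsto g x U"
    unfolding weakly_tendsto_def using lim by simp
  then show ?thesis
    using U_bot unfolding U_def by auto
qed

section \<open>Minimal invariant sets\<close>

definition invariant_convex :: "('a::real_normed_vector \<Rightarrow> 'a) \<Rightarrow> 'a set \<Rightarrow> bool" where
  "invariant_convex T K \<longleftrightarrow> K \<noteq> {} \<and> closed K \<and> convex K \<and> T \<in> K \<rightarrow> K"

definition minimal_invariant_convex :: "('a::real_normed_vector \<Rightarrow> 'a) \<Rightarrow> 'a set \<Rightarrow> bool" where
  "minimal_invariant_convex T K \<longleftrightarrow>
     invariant_convex T K \<and> (\<forall>L\<subseteq>K. invariant_convex T L \<longrightarrow> L = K)"

text \<open>Zorn's lemma for reverse inclusion. A chain has nonempty intersection: choose a point in each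
  member and take a weak cluster point of these points along the chain; it lies in every member, as
  the members are closed and convex.\<close>

lemma minimal_invariant_convex_exists:
  fixes C :: "'a::real_normed_vector set"
  assumes refl: "reflexive_space TYPE('a)" and C: "invariant_convex T C" "bounded C"
  shows "\<exists>K\<subseteq>C. minimal_invariant_convex T K"
proof -
  define A where "A = {K. K \<subseteq> C \<and> invariant_convex T K}"
  have po: "partial_order_on A (relation_of (\<lambda>K L. L \<subseteq> K) A)"
    by (rule partial_order_on_relation_ofI) auto
  have "\<exists>K\<in>A. \<forall>L\<in>A. L \<subseteq> K \<longrightarrow> L = K"
  proof (rule predicate_Zorn[OF po])
    fix Q assume Q: "Q \<in> Chains (relation_of (\<lambda>K L. L \<subseteq> K) A)"
    have QA: "Q \<subseteq> A" by (rule Chains_relation_of[OF Q])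
    have total: "K \<subseteq> L \<or> L \<subseteq> K" if "K \<in> Q" "L \<in> Q" for K L
      using Q that unfolding Chains_def relation_of_def by auto
    show "\<exists>L\<in>A. \<forall>K\<in>Q. L \<subseteq> K"
    proof (cases "Q = {}")
      case True
      then show ?thesis using C unfolding A_def by auto
    next
      case False
      have inv: "K \<noteq> {}" "closed K" "convex K" "T \<in> K \<rightarrow> K" "K \<subseteq> C" if "K \<in> Q" for K
        using QA that unfolding A_def invariant_convex_def by auto
      \<comment> \<open>\<open>F\<close> consists of the tails of the chain\<close>
      define F where "F = (INF L\<in>Q. principal {K \<in> Q. K \<subseteq> L})"
      have ev_F: "eventually P F \<longleftrightarrow> (\<exists>L\<in>Q. \<forall>K\<in>Q. K \<subseteq> L \<longrightarrow> P K)" for P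
      proof -
        have "\<exists>x\<in>Q. principal {K \<in> Q. K \<subseteq> x}
            \<le> inf (principal {K \<in> Q. K \<subseteq> a}) (principal {K \<in> Q. K \<subseteq> b})"
          if "a \<in> Q" "b \<in> Q" for a b
          using total[OF that] that by auto
        then have "eventually P F \<longleftrightarrow> (\<exists>L\<in>Q. eventually P (principal {K \<in> Q. K \<subseteq> L}))"
          unfolding F_def by (intro eventually_INF_base[OF False])
        then show ?thesis unfolding eventually_principal by blast
      qed
      have "F \<noteq> bot"
        unfolding trivial_limit_def ev_F by auto
      obtain M where M: "0 < M" "\<And>x. x \<in> C \<Longrightarrow> norm x \<le> M"
        using C(2) bounded_pos by blast
      define g where "g K = (if K \<in> Q then SOME x. x \<in> K else 0)" for K
      have g: "g K \<in> K" if "K \<in> Q" for K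
        using inv(1)[OF that] that unfolding g_def by (simp add: some_in_eq)
      have "norm (g K) \<le> M" for K
        using g[of K] inv(5)[of K] M by (cases "K \<in> Q") (auto simp: g_def)
      then obtain U x where U: "U \<noteq> bot" "U \<le> F" "weakly_tendsto g x U"
        using weak_cluster_point[OF refl \<open>F \<noteq> bot\<close>] by blast
      have x: "x \<in> K" if K: "K \<in> Q" for K
      proof (rule weak_limit_in_closed_convex[OF U(3,1) inv(3,2)[OF K]])
        have "eventually (\<lambda>L. g L \<in> K) F"
          unfolding ev_F using K g by blast
        then show "eventually (\<lambda>L. g L \<in> K) U"
          using U(2) filter_leD by blast
      qed
      have "invariant_convex T (\<Inter>Q)"
        unfolding invariant_convex_def
      proof (intro conjI)
        show "closed (\<Inter>Q)" "convex (\<Inter>Q)"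
          using inv by (auto intro: closed_Inter convex_Inter)
        show "T \<in> \<Inter>Q \<rightarrow> \<Inter>Q"
          using inv(4) by blast
        show "\<Inter>Q \<noteq> {}"
          using x by blast
      qed
      then show ?thesis
        using inv(5) False unfolding A_def by blast
    qed
  qed
  then obtain K where "K \<in> A" and min: "\<And>L. L \<in> A \<Longrightarrow> L \<subseteq> K \<Longrightarrow> L = K"
    by auto
  then have K: "K \<subseteq> C" "invariant_convex T K"
    unfolding A_def by auto
  have "L = K" if "L \<subseteq> K" "invariant_convex T L" for L
    using min[of L] that K(1) unfolding A_def by auto
  then show ?thesis
    using K unfolding minimal_invariant_convex_def by blast
qed

text \<open>Almost fixed points of \<open>T\<close> are almost diametral. Otherwise some sequence \<open>v\<close> of almost fixed points stays
  within \<open>r < diameter K\<close> of \<open>p\<close>. The points that are asymptotically within \<open>r\<close> of \<open>v\<close> form an invariant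
  set, so by minimality they are all of \<open>K\<close>, and a weak cluster point \<open>u\<close> of \<open>v\<close> is then within \<open>r\<close> of
  every point of \<open>K\<close>. The set \<open>N\<close> of such centres is again invariant, hence equal to \<open>K\<close>, and so the
  diameter of \<open>K\<close> would be at most \<open>r\<close>.\<close>

lemma goebel_karlovitz:
  fixes K :: "'a::real_normed_vector set"
  assumes refl: "reflexive_space TYPE('a)" and K: "minimal_invariant_convex T K" "bounded K"
    and T: "nonexpansive_on K T" and p: "p \<in> K" and \<delta>: "0 < \<delta>"
  shows "\<exists>\<epsilon>>0. \<forall>v\<in>K. norm (v - T v) \<le> \<epsilon> \<longrightarrow> diameter K - \<delta> \<le> norm (v - p)"
proof (rule ccontr)
  define r where "r = diameter K - \<delta>"
  have closed: "closed K" and convex: "convex K" and TK: "\<And>x. x \<in> K \<Longrightarrow> T x \<in> K"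
    and minimal: "\<And>L. L \<subseteq> K \<Longrightarrow> invariant_convex T L \<Longrightarrow> L = K"
    using K(1) unfolding minimal_invariant_convex_def invariant_convex_def by auto
  have T_le: "norm (T x - T y) \<le> norm (x - y)" if "x \<in> K" "y \<in> K" for x y
    using T that unfolding nonexpansive_on_def by blast
  assume contr: "\<not> ?thesis"
  have "\<exists>v\<in>K. norm (v - T v) \<le> inverse (real (Suc n)) \<and> norm (v - p) < r" for n
  proof (rule ccontr)
    assume "\<not> ?thesis"
    then have "\<forall>v\<in>K. norm (v - T v) \<le> inverse (real (Suc n)) \<longrightarrow> diameter K - \<delta> \<le> norm (v - p)"
      unfolding r_def by force
    then show False
      using contr by (metis inverse_positive_iff_positive of_nat_0_less_iff zero_less_Suc)
  qed
  then obtain v where v: "\<And>n. v n \<in> K" "\<And>n. norm (v n - T (v n)) \<le> inverse (real (Suc n))"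
      "\<And>n. norm (v n - p) < r"
    by metis
  define L where "L = {k \<in> K. \<forall>\<eta>>0. eventually (\<lambda>n. norm (v n - k) \<le> r + \<eta>) sequentially}"
  have "invariant_convex T L"
    unfolding invariant_convex_def
  proof (intro conjI)
    have "p \<in> L"
      using p v(3) unfolding L_def by (auto intro!: always_eventually simp: add_increasing2 less_imp_le)
    then show "L \<noteq> {}" by blast
    show "closed L"
    proof (unfold closed_sequential_limits, intro allI impI, elim conjE)
      fix k l assume k: "\<forall>n. k n \<in> L" "k \<longlonglongrightarrow> l"
      have "l \<in> K"
        using closed_sequentially[OF closed, of k] k unfolding L_def by blast
      moreover have "eventually (\<lambda>n. norm (v n - l) \<le> r + \<eta>) sequentially" if \<eta>: "0 < \<eta>" for \<eta>
      proof -
        obtain m where m: "norm (k m - l) < \<eta> / 2"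
          using LIMSEQ_D[OF k(2), of "\<eta> / 2"] \<eta> by auto
        have "eventually (\<lambda>n. norm (v n - k m) \<le> r + \<eta> / 2) sequentially"
          using k(1) \<eta> unfolding L_def by auto
        then show ?thesis
        proof eventually_elim
          case (elim n)
          then show ?case
            using m norm_triangle_ineq[of "v n - k m" "k m - l"] by simp
        qed
      qed
      ultimately show "l \<in> L" unfolding L_def by blast
    qed
    show "convex L"
    proof (rule convexI)
      fix x y and a b :: real
      assume xy: "x \<in> L" "y \<in> L" and ab: "0 \<le> a" "0 \<le> b" "a + b = 1"
      have "a *\<^sub>R x + b *\<^sub>R y \<in> K"
        using convexD[OF convex _ _ ab] xy unfolding L_def by blast
      moreover have "eventually (\<lambda>n. norm (v n - (a *\<^sub>R x + b *\<^sub>R y)) \<le> r + \<eta>) sequentially"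
        if \<eta>: "0 < \<eta>" for \<eta>
      proof -
        have "eventually (\<lambda>n. norm (v n - x) \<le> r + \<eta>) sequentially"
          "eventually (\<lambda>n. norm (v n - y) \<le> r + \<eta>) sequentially"
          using xy \<eta> unfolding L_def by auto
        then show ?thesis
        proof eventually_elim
          case (elim n)
          have "x \<in> cball (v n) (r + \<eta>)" "y \<in> cball (v n) (r + \<eta>)"
            using elim by (auto simp: dist_norm)
          then have "a *\<^sub>R x + b *\<^sub>R y \<in> cball (v n) (r + \<eta>)"
            using convexD[OF convex_cball _ _ ab] by blast
          then show ?case by (simp add: dist_norm)
        qed
      qed
      ultimately show "a *\<^sub>R x + b *\<^sub>R y \<in> L" unfolding L_def by blast
    qed
    show "T \<in> L \<rightarrow> L"
    proof
      fix k assume k: "k \<in> L"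
      then have kK: "k \<in> K" unfolding L_def by blast
      have "eventually (\<lambda>n. norm (v n - T k) \<le> r + \<eta>) sequentially" if \<eta>: "0 < \<eta>" for \<eta>
      proof -
        have "eventually (\<lambda>n. norm (v n - k) \<le> r + \<eta> / 2) sequentially"
          using k \<eta> unfolding L_def by auto
        moreover have "eventually (\<lambda>n. inverse (real (Suc n)) < \<eta> / 2) sequentially"
          using order_tendstoD(2)[OF LIMSEQ_inverse_real_of_nat, of "\<eta> / 2"] \<eta> by simp
        ultimately show ?thesis
        proof eventually_elim
          case (elim n)
          have "norm (v n - T k) \<le> norm (v n - T (v n)) + norm (T (v n) - T k)"
            using norm_triangle_ineq[of "v n - T (v n)" "T (v n) - T k"] by simp
          also have "\<dots> \<le> \<eta> / 2 + (r + \<eta> / 2)"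
            using v(2)[of n] T_le[OF v(1) kK, of n] elim by linarith
          finally show ?case by simp
        qed
      qed
      then show "T k \<in> L"
        unfolding L_def using TK[OF kK] by blast
    qed
  qed
  moreover have "L \<subseteq> K" unfolding L_def by blast
  ultimately have LK: "L = K" by (intro minimal)
  obtain M where "\<And>n. norm (v n) \<le> M"
    using K(2) v(1) unfolding bounded_iff by blast
  then obtain U u where U: "U \<noteq> bot" "U \<le> sequentially" "weakly_tendsto v u U"
    using weak_cluster_point[OF refl sequentially_bot] by blast
  have uK: "u \<in> K"
    by (rule weak_limit_in_closed_convex[OF U(3,1) convex closed]) (use v(1) in simp)
  have u_le: "norm (u - k) \<le> r" if k: "k \<in> K" for k
  proof (rule field_le_epsilon)
    fix \<eta> :: real assume \<eta>: "0 < \<eta>"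
    have "eventually (\<lambda>n. norm (v n - k) \<le> r + \<eta>) sequentially"
      using k \<eta> LK unfolding L_def by blast
    then have "eventually (\<lambda>n. v n \<in> cball k (r + \<eta>)) U"
      using filter_leD[OF U(2)] by (simp add: dist_norm norm_minus_commute)
    from weak_limit_in_closed_convex[OF U(3,1) convex_cball closed_cball this]
    show "norm (u - k) \<le> r + \<eta>"
      by (simp add: dist_norm norm_minus_commute)
  qed
  define N where "N = (\<Inter>y\<in>K. K \<inter> cball y r)"
  have N: "k \<in> N \<longleftrightarrow> k \<in> K \<and> (\<forall>y\<in>K. norm (k - y) \<le> r)" for k
    using p unfolding N_def by (auto simp: dist_norm norm_minus_commute)
  have "invariant_convex T N"
    unfolding invariant_convex_def
  proof (intro conjI)
    show "N \<noteq> {}" using uK u_le N by blast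
    show "closed N" unfolding N_def using closed by (intro closed_INT ballI closed_Int) auto
    show "convex N" unfolding N_def using convex by (intro convex_INT convex_Int) auto
    show "T \<in> N \<rightarrow> N"
    proof
      fix k assume k: "k \<in> N"
      \<comment> \<open>\<open>T k\<close> need not be near every point of \<open>K\<close> a priori, but the points near it form an invariant set\<close>
      have "invariant_convex T (K \<inter> cball (T k) r)"
        unfolding invariant_convex_def
      proof (intro conjI)
        have "0 \<le> r" using u_le[OF uK] by simp
        then have "T k \<in> K \<inter> cball (T k) r" using TK k N by simp
        then show "K \<inter> cball (T k) r \<noteq> {}" by blast
        show "closed (K \<inter> cball (T k) r)" using closed by (intro closed_Int) auto
        show "convex (K \<inter> cball (T k) r)" using convex by (intro convex_Int) auto
        show "T \<in> K \<inter> cball (T k) r \<rightarrow> K \<inter> cball (T k) r"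
        proof
          fix y assume "y \<in> K \<inter> cball (T k) r"
          then show "T y \<in> K \<inter> cball (T k) r"
            using k N TK T_le[of k y] by (fastforce simp: dist_norm)
        qed
      qed
      then have "K \<inter> cball (T k) r = K" by (intro minimal) auto
      then show "T k \<in> N"
        using N TK k by (fastforce simp: dist_norm)
    qed
  qed
  then have NK: "N = K"
    using N by (intro minimal) auto
  have "diameter K \<le> r"
  proof (rule diameter_le)
    show "K \<noteq> {} \<or> 0 \<le> r" using p by blast
    show "norm (x - y) \<le> r" if "x \<in> K" "y \<in> K" for x y
      using N NK that by blast
  qed
  then show False using \<delta> unfolding r_def by simp
qed

section \<open>The resolvent of a nonexpansive map\<close>

text \<open>The resolvent sends \<open>b\<close> to the fixed point of the contraction \<open>u \<mapsto> l b + (1 - l) T u\<close>. It turns any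
  point of \<open>K\<close> into an almost fixed point of \<open>T\<close> without increasing distances, either between
  two points or, up to a small error, from a point to one that is already almost fixed.\<close>

definition is_resolvent :: "('a::real_normed_vector \<Rightarrow> 'a) \<Rightarrow> 'a set \<Rightarrow> real \<Rightarrow> ('a \<Rightarrow> 'a) \<Rightarrow> bool" where
  "is_resolvent T K l R \<longleftrightarrow> (\<forall>b\<in>K. R b \<in> K \<and> R b = l *\<^sub>R b + (1 - l) *\<^sub>R T (R b))"

lemma resolvent_exists:
  fixes K :: "'a::banach set"
  assumes K: "invariant_convex T K" and T: "nonexpansive_on K T" and l: "0 < l" "l \<le> 1"
  shows "\<exists>R. is_resolvent T K l R"
proof -
  have K': "closed K" "convex K" "K \<noteq> {}" "\<And>x. x \<in> K \<Longrightarrow> T x \<in> K"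
    using K unfolding invariant_convex_def by auto
  have "\<exists>u\<in>K. l *\<^sub>R b + (1 - l) *\<^sub>R T u = u" if b: "b \<in> K" for b
  proof -
    have "\<exists>!u. u \<in> K \<and> l *\<^sub>R b + (1 - l) *\<^sub>R T u = u"
    proof (rule Banach_fix)
      show "complete K" using K'(1) by (simp add: complete_eq_closed)
      show "K \<noteq> {}" by (rule K'(3))
      show "0 \<le> 1 - l" "1 - l < 1" using l by auto
      show "(\<lambda>u. l *\<^sub>R b + (1 - l) *\<^sub>R T u) ` K \<subseteq> K"
        using convexD[OF K'(2) b K'(4)] l by auto
      fix x y assume "x \<in> K" "y \<in> K"
      then have "norm (T x - T y) \<le> norm (x - y)"
        using T unfolding nonexpansive_on_def by blast
      then show "dist (l *\<^sub>R b + (1 - l) *\<^sub>R T x) (l *\<^sub>R b + (1 - l) *\<^sub>R T y) \<le> (1 - l) * dist x y"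
        using l(2) by (simp add: dist_norm mult_left_mono flip: scaleR_diff_right)
    qed
    then show ?thesis by blast
  qed
  then show ?thesis
    unfolding is_resolvent_def by metis
qed

lemma resolvent_nonexpansive:
  assumes R: "is_resolvent T K l R" and T: "nonexpansive_on K T" and l: "0 < l" "l \<le> 1"
    and bc: "b \<in> K" "c \<in> K"
  shows "norm (R b - R c) \<le> norm (b - c)"
proof -
  have K: "R b \<in> K" "R c \<in> K"
    and eq: "R b = l *\<^sub>R b + (1 - l) *\<^sub>R T (R b)" "R c = l *\<^sub>R c + (1 - l) *\<^sub>R T (R c)"
    using R bc unfolding is_resolvent_def by auto
  have "R b - R c = l *\<^sub>R (b - c) + (1 - l) *\<^sub>R (T (R b) - T (R c))"
    by (subst eq(1), subst eq(2)) (simp add: algebra_simps)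
  then have "norm (R b - R c) \<le> l * norm (b - c) + (1 - l) * norm (T (R b) - T (R c))"
    using norm_triangle_ineq[of "l *\<^sub>R (b - c)" "(1 - l) *\<^sub>R (T (R b) - T (R c))"] l by simp
  also have "\<dots> \<le> l * norm (b - c) + (1 - l) * norm (R b - R c)"
    using T K l unfolding nonexpansive_on_def by (intro add_mono mult_left_mono) auto
  finally have "l * norm (R b - R c) \<le> l * norm (b - c)"
    by (simp add: algebra_simps)
  then show ?thesis using l by simp
qed

lemma norm_add3_le:
  fixes a b c :: "'a::real_normed_vector"
  shows "norm (a + b + c) \<le> norm a + norm b + norm c"
  using norm_triangle_ineq[of "a + b" c] norm_triangle_ineq[of a b] by linarith

lemma resolvent_near_almost_fixed:
  assumes R: "is_resolvent T K l R" and T: "nonexpansive_on K T" and l: "0 < l" "l \<le> 1"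
    and bx: "b \<in> K" "x \<in> K" and x: "norm (x - T x) \<le> l * \<eta>"
  shows "norm (R b - x) \<le> norm (b - x) + \<eta>"
proof -
  have K: "R b \<in> K" and eq: "R b = l *\<^sub>R b + (1 - l) *\<^sub>R T (R b)"
    using R bx unfolding is_resolvent_def by auto
  have "R b - x = l *\<^sub>R (b - x) + (1 - l) *\<^sub>R (T (R b) - T x) + (1 - l) *\<^sub>R (T x - x)"
    by (subst eq) (simp add: algebra_simps)
  then have "norm (R b - x) \<le> norm (l *\<^sub>R (b - x)) + norm ((1 - l) *\<^sub>R (T (R b) - T x))
      + norm ((1 - l) *\<^sub>R (T x - x))"
    by (simp only: norm_add3_le)
  also have "\<dots> = l * norm (b - x) + (1 - l) * norm (T (R b) - T x) + (1 - l) * norm (x - T x)"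
    using l by (simp add: norm_minus_commute)
  also have "\<dots> \<le> l * norm (b - x) + (1 - l) * norm (R b - x) + 1 * (l * \<eta>)"
    using T K bx l x unfolding nonexpansive_on_def
    by (intro add_mono mult_left_mono mult_mono) auto
  \<comment> \<open>the error of \<open>x\<close> is measured against \<open>l\<close>, because it is divided by \<open>l\<close> here\<close>
  finally have "l * norm (R b - x) \<le> l * (norm (b - x) + \<eta>)"
    by (simp add: algebra_simps)
  then show ?thesis using l by simp
qed

lemma resolvent_almost_fixed:
  assumes R: "is_resolvent T K l R" and K: "T \<in> K \<rightarrow> K" "bounded K" and l: "0 < l"
    and b: "b \<in> K"
  shows "norm (R b - T (R b)) \<le> l * diameter K"
proof -
  have RK: "R b \<in> K" and eq: "R b = l *\<^sub>R b + (1 - l) *\<^sub>R T (R b)"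
    using R b unfolding is_resolvent_def by auto
  have "R b - T (R b) = l *\<^sub>R (b - T (R b))"
    by (subst eq) (simp add: algebra_simps)
  then show ?thesis
    using diameter_bounded_bound[OF K(2) b, of "T (R b)"] RK K(1) l
    by (auto simp: dist_norm)
qed

section \<open>Partial sum projections of a D-unconditional basis\<close>

definition basis_coeff :: "(nat \<Rightarrow> 'a::real_normed_vector) \<Rightarrow> 'a \<Rightarrow> nat \<Rightarrow> real" where
  "basis_coeff e x = (THE a. (\<lambda>n. a n *\<^sub>R e n) sums x)"

definition partial_sum_proj :: "(nat \<Rightarrow> 'a::real_normed_vector) \<Rightarrow> nat \<Rightarrow> 'a \<Rightarrow> 'a" where
  "partial_sum_proj e N x = (\<Sum>n<N. basis_coeff e x n *\<^sub>R e n)"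

lemma basis_coeff_sums:
  assumes "schauder_basis e" shows "(\<lambda>n. basis_coeff e x n *\<^sub>R e n) sums x"
  unfolding basis_coeff_def using assms unfolding schauder_basis_def by (metis (mono_tags) theI')

lemma basis_coeff_unique:
  assumes "schauder_basis e" "(\<lambda>n. a n *\<^sub>R e n) sums x" shows "basis_coeff e x = a"
  using assms basis_coeff_sums[OF assms(1), of x] unfolding schauder_basis_def by blast

lemma basis_coeff_add:
  assumes e: "schauder_basis e"
  shows "basis_coeff e (x + y) = (\<lambda>n. basis_coeff e x n + basis_coeff e y n)"
  using sums_add[OF basis_coeff_sums[OF e, of x] basis_coeff_sums[OF e, of y]]
  by (intro basis_coeff_unique[OF e]) (simp add: scaleR_left_distrib)

lemma basis_coeff_scaleR:
  assumes e: "schauder_basis e"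
  shows "basis_coeff e (r *\<^sub>R x) = (\<lambda>n. r * basis_coeff e x n)"
  using sums_scaleR_right[OF basis_coeff_sums[OF e, of x], of r]
  by (intro basis_coeff_unique[OF e]) simp

lemma linear_partial_sum_proj:
  assumes e: "schauder_basis e" shows "linear (partial_sum_proj e N)"
  by (rule linearI)
    (simp_all add: partial_sum_proj_def basis_coeff_add[OF e] basis_coeff_scaleR[OF e]
      scaleR_left_distrib sum.distrib scaleR_sum_right)

lemma partial_sum_proj_tendsto:
  assumes "schauder_basis e" shows "(\<lambda>N. partial_sum_proj e N x) \<longlonglongrightarrow> x"
  using basis_coeff_sums[OF assms, of x] unfolding sums_def partial_sum_proj_def .

lemma basis_vector_nonzero:
  assumes e: "schauder_basis e" shows "e n \<noteq> 0"
proof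
  assume "e n = 0"
  then have "(\<lambda>k. (if k = n then 1 else 0) *\<^sub>R e k) = (\<lambda>k. 0)"
    by auto
  then have "(\<lambda>k. (if k = n then 1 else 0) *\<^sub>R e k) sums 0" "(\<lambda>k. 0 *\<^sub>R e k) sums 0"
    by simp_all
  from this[THEN basis_coeff_unique[OF e]] have "(\<lambda>k. if k = n then 1 else 0) = (\<lambda>k. 0 :: real)"
    by simp
  then show False by (metis zero_neq_one)
qed

lemma D_unconditional_schauder: "D_unconditional_basis D e \<Longrightarrow> schauder_basis e"
  unfolding D_unconditional_basis_def unconditional_basis_def by blast

text \<open>Only sign patterns that are \<open>- 1\<close> on a block \<open>{M..<N}\<close> and \<open>1\<close> elsewhere are used. Their signed series
  differ from the expansion in finitely many terms, so they converge to an explicit sum.\<close>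

lemma norm_flip_block_le:
  assumes e: "D_unconditional_basis D e" and MN: "M \<le> N"
  shows "norm (x - 2 *\<^sub>R (partial_sum_proj e N x - partial_sum_proj e M x)) \<le> D * norm x"
proof -
  let ?a = "basis_coeff e x"
  let ?\<epsilon> = "\<lambda>n. if n \<in> {M..<N} then - 1 else (1 :: real)"
  note s = basis_coeff_sums[OF D_unconditional_schauder[OF e], of x]
  have "(\<lambda>n. if n \<in> {M..<N} then ?a n *\<^sub>R e n else 0) sums (\<Sum>n\<in>{M..<N}. ?a n *\<^sub>R e n)"
    by (rule sums_If_finite_set) simp
  also have "(\<Sum>n\<in>{M..<N}. ?a n *\<^sub>R e n) = partial_sum_proj e N x - partial_sum_proj e M x"
    using sum.atLeastLessThan_concat[of 0 M N "\<lambda>n. ?a n *\<^sub>R e n"] MN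
    by (simp add: partial_sum_proj_def atLeast0LessThan algebra_simps)
  finally have "(\<lambda>n. ?a n *\<^sub>R e n - 2 *\<^sub>R (if n \<in> {M..<N} then ?a n *\<^sub>R e n else 0))
      sums (x - 2 *\<^sub>R (partial_sum_proj e N x - partial_sum_proj e M x))"
    by (intro sums_diff s sums_scaleR_right)
  also have "(\<lambda>n. ?a n *\<^sub>R e n - 2 *\<^sub>R (if n \<in> {M..<N} then ?a n *\<^sub>R e n else 0))
      = (\<lambda>n. ?\<epsilon> n *\<^sub>R ?a n *\<^sub>R e n)"
    by (auto simp: scaleR_2)
  finally have "(\<Sum>n. ?\<epsilon> n *\<^sub>R ?a n *\<^sub>R e n) =
      x - 2 *\<^sub>R (partial_sum_proj e N x - partial_sum_proj e M x)"
    by (rule sums_unique[symmetric])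
  moreover have "norm (\<Sum>n. ?\<epsilon> n *\<^sub>R ?a n *\<^sub>R e n) \<le> D * norm (\<Sum>n. ?a n *\<^sub>R e n)"
  proof -
    have "range ?\<epsilon> \<subseteq> {- 1, 1}" by auto
    with e s[THEN sums_summable] show ?thesis
      unfolding D_unconditional_basis_def by blast
  qed
  moreover have "(\<Sum>n. ?a n *\<^sub>R e n) = x"
    using s by (rule sums_unique[symmetric])
  ultimately show ?thesis by simp
qed

lemma unconditional_constant_ge_1:
  assumes e: "D_unconditional_basis D e" shows "1 \<le> D"
  using norm_flip_block_le[OF e order_refl[of 0], of "e 0"]
    basis_vector_nonzero[OF D_unconditional_schauder[OF e], of 0]
  by simp

text \<open>Removing a block averages the identity and the sign change on that block.\<close>

lemma norm_remove_block_le: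
  assumes e: "D_unconditional_basis D e" and MN: "M \<le> N"
  shows "norm (x - (partial_sum_proj e N x - partial_sum_proj e M x)) \<le> (1 + D) / 2 * norm x"
proof -
  let ?P = "partial_sum_proj e N x - partial_sum_proj e M x"
  have "x - ?P = (1 / 2) *\<^sub>R (x + (x - 2 *\<^sub>R ?P))"
    by (simp add: scaleR_right_diff_distrib scaleR_right_distrib flip: scaleR_2)
  then have "norm (x - ?P) \<le> (norm x + norm (x - 2 *\<^sub>R ?P)) / 2"
    using norm_triangle_ineq[of x "x - 2 *\<^sub>R ?P"] by simp
  also have "\<dots> \<le> (norm x + D * norm x) / 2"
    using norm_flip_block_le[OF e MN, of x] by simp
  finally show ?thesis by (simp add: algebra_simps)
qed

lemma norm_remove_initial_le:
  assumes e: "D_unconditional_basis D e"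
  shows "norm (x - partial_sum_proj e N x) \<le> (1 + D) / 2 * norm x"
  using norm_remove_block_le[OF e, of 0 N x] by (simp add: partial_sum_proj_def)

text \<open>A coordinate is a block of length one, so its continuity comes from the unconditionality constant.\<close>

lemma bounded_linear_basis_coeff:
  assumes e: "D_unconditional_basis D e" shows "bounded_linear (\<lambda>x. basis_coeff e x n)"
proof (rule bounded_linear_intro)
  note s = D_unconditional_schauder[OF e]
  show "basis_coeff e (x + y) n = basis_coeff e x n + basis_coeff e y n" for x y
    by (simp add: basis_coeff_add[OF s])
  show "basis_coeff e (r *\<^sub>R x) n = r *\<^sub>R basis_coeff e x n" for r x
    by (simp add: basis_coeff_scaleR[OF s])
  show "norm (basis_coeff e x n) \<le> norm x * ((1 + (1 + D) / 2) / norm (e n))" for x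
  proof -
    let ?P = "partial_sum_proj e (Suc n) x - partial_sum_proj e n x"
    have "?P = basis_coeff e x n *\<^sub>R e n"
      by (simp add: partial_sum_proj_def)
    then have "\<bar>basis_coeff e x n\<bar> * norm (e n) = norm (x - (x - ?P))"
      by simp
    also have "\<dots> \<le> norm x + (1 + D) / 2 * norm x"
      using norm_triangle_ineq4[of x "x - ?P"] norm_remove_block_le[OF e, of n "Suc n" x] by simp
    finally show ?thesis
      using basis_vector_nonzero[OF s, of n] by (simp add: field_simps)
  qed
qed

lemma partial_sum_proj_weakly_tendsto:
  assumes e: "D_unconditional_basis D e" and g: "weakly_tendsto g x F"
  shows "((\<lambda>i. partial_sum_proj e N (g i)) \<longlongrightarrow> partial_sum_proj e N x) F"
  unfolding partial_sum_proj_def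
proof (intro tendsto_sum tendsto_scaleR tendsto_const)
  fix n
  let ?c = "Blinfun (\<lambda>x. basis_coeff e x n)"
  have c: "blinfun_apply ?c = (\<lambda>x. basis_coeff e x n)"
    by (rule bounded_linear_Blinfun_apply[OF bounded_linear_basis_coeff[OF e]])
  have "((\<lambda>i. ?c (g i)) \<longlongrightarrow> ?c x) F"
    using g unfolding weakly_tendsto_def by blast
  then show "((\<lambda>i. basis_coeff e (g i) n) \<longlongrightarrow> basis_coeff e x n) F"
    unfolding c .
qed

section \<open>The fixed point theorem\<close>

text \<open>Changing the sign of all coordinates from \<open>N\<close> on turns \<open>x - y\<close> into \<open>x + y\<close>, up to the parts of the two
  vectors that lie on the wrong side of \<open>N\<close>.\<close>

lemma norm_add_le_of_almost_disjoint:
  assumes e: "D_unconditional_basis D e"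
    and x: "norm (x - partial_sum_proj e N x) \<le> \<eta>" and y: "norm (partial_sum_proj e N y) \<le> \<eta>"
  shows "norm (x + y) \<le> D * norm (x - y) + 4 * \<eta>"
proof -
  let ?E = "partial_sum_proj e N"
  have E: "?E (x - y) = ?E x - ?E y"
    by (rule linear_diff[OF linear_partial_sum_proj[OF D_unconditional_schauder[OF e]]])
  have flip: "norm (- ((x - y) - 2 *\<^sub>R ?E (x - y))) \<le> D * norm (x - y)"
    using norm_flip_block_le[OF e, of 0 N "x - y"]
    unfolding norm_minus_cancel by (simp add: partial_sum_proj_def)
  have "x + y = - ((x - y) - 2 *\<^sub>R ?E (x - y)) + 2 *\<^sub>R (x - ?E x) + 2 *\<^sub>R ?E y"
    unfolding E by (simp add: algebra_simps scaleR_2)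
  then have "norm (x + y) \<le> norm (- ((x - y) - 2 *\<^sub>R ?E (x - y)))
      + norm (2 *\<^sub>R (x - ?E x)) + norm (2 *\<^sub>R ?E y)"
    by (simp only: norm_add3_le)
  also have "\<dots> \<le> D * norm (x - y) + 2 * \<eta> + 2 * \<eta>"
    using x y by (intro add_mono flip) auto
  finally show ?thesis by simp
qed

text \<open>The supports are ordered: \<open>z\<close> lives before \<open>M\<close> and \<open>x\<close> between \<open>M\<close> and \<open>N\<close>. Writing \<open>E\<close> for the partial sum
  projections, the identity \<open>2 = E N + (1 - E N + E M) + (1 - E M)\<close> splits \<open>w\<close> so that the second
  operator annihilates \<open>x\<close> and the third annihilates \<open>z\<close>; both remove a block. The first term is left as
  it is, since for the vector \<open>w\<close> of interest a weak limit bounds it better than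
  any norm bound for \<open>E N\<close>.\<close>

lemma norm_le_of_three_close_points:
  assumes e: "D_unconditional_basis D e" and MN: "M \<le> N"
    and z: "norm (z - partial_sum_proj e M z) \<le> \<eta>"
    and x: "norm (x - partial_sum_proj e N x) \<le> \<eta>" "norm (partial_sum_proj e M x) \<le> \<eta>"
  shows "2 * norm w \<le> norm (partial_sum_proj e N w)
    + (1 + D) / 2 * (norm (w - x) + norm (w - z)) + 3 * \<eta>"
proof -
  let ?E = "partial_sum_proj e"
  have diff: "?E K (u - v) = ?E K u - ?E K v" for K u v
    by (rule linear_diff[OF linear_partial_sum_proj[OF D_unconditional_schauder[OF e]]])
  define A where "A u = u - (?E N u - ?E M u)" for u
  define B where "B u = u - ?E M u" for u
  have A: "norm (A w) \<le> (1 + D) / 2 * norm (w - x) + 2 * \<eta>"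
  proof -
    have "A w = A (w - x) + (x - ?E N x) + ?E M x"
      unfolding A_def diff by simp
    then have "norm (A w) \<le> norm (A (w - x)) + norm (x - ?E N x) + norm (?E M x)"
      by (simp only: norm_add3_le)
    then show ?thesis
      using norm_remove_block_le[OF e MN, of "w - x"] x unfolding A_def by linarith
  qed
  have B: "norm (B w) \<le> (1 + D) / 2 * norm (w - z) + \<eta>"
  proof -
    have "B w = B (w - z) + (z - ?E M z)"
      unfolding B_def diff by simp
    then have "norm (B w) \<le> norm (B (w - z)) + norm (z - ?E M z)"
      by (metis norm_triangle_ineq)
    then show ?thesis
      using norm_remove_initial_le[OF e, of "w - z" M] z unfolding B_def by linarith
  qed
  have "2 *\<^sub>R w = ?E N w + A w + B w"
    unfolding A_def B_def by (simp add: scaleR_2)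
  then have "2 * norm w = norm (?E N w + A w + B w)"
    by (metis norm_scaleR abs_numeral)
  also have "\<dots> \<le> norm (?E N w) + norm (A w) + norm (B w)"
    by (rule norm_add3_le)
  finally show ?thesis
    using A B by (simp add: algebra_simps)
qed

text \<open>All vectors are taken relative to the weak limit \<open>p\<close> of a sequence \<open>X\<close> of almost fixed points. The order of
  the choices matters: first the parameter \<open>l\<close> and \<open>z\<close>, then \<open>M'\<close> beyond which \<open>z - p\<close> is negligible, then a
  member \<open>x\<close> of the sequence that is negligible before \<open>M'\<close>, then the weak limit \<open>w\<^sub>0\<close> of the resolvents
  of the midpoints of \<open>x\<close> and \<open>X n\<close>, then \<open>N\<close> beyond which \<open>x - p\<close> and \<open>w\<^sub>0 - p\<close> are
  negligible, and only at the end the index \<open>n\<close>.\<close>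

lemma diameter_minimal_invariant_bound:
  fixes e :: "nat \<Rightarrow> 'a::banach" and K :: "'a set"
  assumes refl: "reflexive_space TYPE('a)" and e: "D_unconditional_basis D e"
    and K: "minimal_invariant_convex T K" "bounded K" and T: "nonexpansive_on K T"
    and \<eta>: "0 < \<eta>"
  shows "2 * diameter K \<le> (1 / 2 + (1 + D)\<^sup>2 / 4) * diameter K + (8 + 3 * D) * \<eta>"
proof -
  let ?E = "partial_sum_proj e"
  let ?d = "diameter K"
  note s = D_unconditional_schauder[OF e]
  have E_diff: "?E N (u - v) = ?E N u - ?E N v" for N u v
    by (rule linear_diff[OF linear_partial_sum_proj[OF s]])
  have D1: "1 \<le> D" by (rule unconditional_constant_ge_1[OF e])
  have inv: "invariant_convex T K"
    using K(1) unfolding minimal_invariant_convex_def by blast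
  then have K': "closed K" "convex K" "K \<noteq> {}" "T \<in> K \<rightarrow> K"
    unfolding invariant_convex_def by auto
  have d: "norm (u - v) \<le> ?d" if "u \<in> K" "v \<in> K" for u v
    using diameter_bounded_bound[OF K(2) that] by (simp add: dist_norm)
  have d0: "0 \<le> ?d"
    using diameter_ge_0[OF K(2)] .
  obtain M where bound: "\<And>u. u \<in> K \<Longrightarrow> norm u \<le> M"
    using K(2) unfolding bounded_iff by blast
  have tail: "eventually (\<lambda>N. norm (u - ?E N u) \<le> \<eta>) sequentially" for u
  proof -
    have "eventually (\<lambda>N. dist (?E N u) u < \<eta>) sequentially"
      using tendstoD[OF partial_sum_proj_tendsto[OF s] \<eta>] .
    then show ?thesis
      by eventually_elim (simp add: dist_norm norm_minus_commute)
  qed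
  obtain b0 where b0: "b0 \<in> K" using K'(3) by blast
  have "\<forall>n. \<exists>R. is_resolvent T K (inverse (real (Suc n))) R"
    using resolvent_exists[OF inv T] by (auto simp: inverse_le_1_iff)
  then obtain R' where R': "\<And>n. is_resolvent T K (inverse (real (Suc n))) (R' n)"
    by metis
  define X where "X n = R' n b0" for n
  have XK: "X n \<in> K" for n
    using R' b0 unfolding X_def is_resolvent_def by blast
  have X_fixed: "norm (X n - T (X n)) \<le> inverse (real (Suc n)) * ?d" for n
    unfolding X_def using resolvent_almost_fixed[OF R' K'(4) K(2) _ b0] by simp
  have lim0: "(\<lambda>n. inverse (real (Suc n)) * ?d) \<longlonglongrightarrow> 0"
    using tendsto_mult_left_zero[OF LIMSEQ_inverse_real_of_nat] .
  have X_ev: "eventually (\<lambda>n. norm (X n - T (X n)) \<le> \<delta>) sequentially" if "0 < \<delta>" for \<delta>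
  proof -
    have "eventually (\<lambda>n. inverse (real (Suc n)) * ?d < \<delta>) sequentially"
      using order_tendstoD(2)[OF lim0 that] .
    then show ?thesis
    proof eventually_elim
      case (elim n)
      then show ?case using X_fixed[of n] by linarith
    qed
  qed
  obtain U p where U: "U \<noteq> bot" "U \<le> sequentially" and Xp: "weakly_tendsto X p U"
    using weak_cluster_point[OF refl sequentially_bot, of X M] bound[OF XK] by blast
  have pK: "p \<in> K"
    by (rule weak_limit_in_closed_convex[OF Xp U(1) K'(2,1)]) (simp add: XK)
  have E_X: "eventually (\<lambda>n. norm (?E N (X n - p)) \<le> \<eta>) U" for N
  proof -
    have "eventually (\<lambda>n. dist (?E N (X n)) (?E N p) < \<eta>) U"
      using tendstoD[OF partial_sum_proj_weakly_tendsto[OF e Xp] \<eta>] .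
    then show ?thesis
      by eventually_elim (simp add: dist_norm E_diff)
  qed
  obtain \<epsilon> where \<epsilon>: "0 < \<epsilon>" "\<And>v. v \<in> K \<Longrightarrow> norm (v - T v) \<le> \<epsilon> \<Longrightarrow> ?d - \<eta> \<le> norm (v - p)"
    using goebel_karlovitz[OF refl K T pK \<eta>] by blast
  \<comment> \<open>resolvents with this parameter are \<open>\<epsilon>\<close>-almost fixed, hence almost diametral from \<open>p\<close>\<close>
  define l where "l = min 1 (\<epsilon> / (?d + 1))"
  have l: "0 < l" "l \<le> 1"
    using \<epsilon>(1) d0 unfolding l_def by auto
  have "l * ?d \<le> \<epsilon> / (?d + 1) * (?d + 1)"
    using l \<epsilon>(1) d0 unfolding l_def by (intro mult_mono) auto
  also have "\<dots> = \<epsilon>" using d0 by simp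
  finally have ld: "l * ?d \<le> \<epsilon>" .
  obtain R where R: "is_resolvent T K l R"
    using resolvent_exists[OF inv T l] by blast
  have RK: "R b \<in> K" if "b \<in> K" for b
    using R that unfolding is_resolvent_def by blast
  have R_far: "?d - \<eta> \<le> norm (R b - p)" if "b \<in> K" for b
    using \<epsilon>(2)[OF RK[OF that]] resolvent_almost_fixed[OF R K'(4) K(2) l(1) that] ld by linarith
  define z where "z = R p"
  have zK: "z \<in> K" unfolding z_def by (rule RK[OF pK])
  obtain M' where M': "norm ((z - p) - ?E M' (z - p)) \<le> \<eta>"
    using eventually_happens'[OF sequentially_bot tail] by blast
  have X_close: "eventually (\<lambda>n. norm (X n - T (X n)) \<le> l * \<eta>) U"
    using filter_leD[OF U(2)] X_ev[of "l * \<eta>"] l \<eta> by simp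
  obtain x where x: "x \<in> K" "norm (x - T x) \<le> l * \<eta>" "norm (?E M' (x - p)) \<le> \<eta>"
    using eventually_happens'[OF U(1) eventually_conj[OF X_close E_X[of M']]] XK by blast
  define m where "m n = (1 / 2) *\<^sub>R (x + X n)" for n
  have mK: "m n \<in> K" for n
    using convexD[OF K'(2) x(1) XK[of n], of "1 / 2" "1 / 2"]
    unfolding m_def by (simp add: scaleR_right_distrib)
  define W where "W n = R (m n)" for n
  have WK: "W n \<in> K" for n unfolding W_def by (rule RK[OF mK])
  have m_x: "norm (m n - x) \<le> ?d / 2" for n
  proof -
    have "m n - x = (1 / 2) *\<^sub>R (X n - x)"
      unfolding m_def by (simp add: algebra_simps flip: scaleR_left_distrib)
    then show ?thesis using d[OF XK[of n] x(1)] by simp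
  qed
  have m_X: "norm (m n - X n) \<le> ?d / 2" for n
  proof -
    have "m n - X n = (1 / 2) *\<^sub>R (x - X n)"
      unfolding m_def by (simp add: algebra_simps flip: scaleR_left_distrib)
    then show ?thesis using d[OF x(1) XK[of n]] by simp
  qed
  have W_x: "norm (W n - x) \<le> ?d / 2 + \<eta>" for n
    using resolvent_near_almost_fixed[OF R T l mK x(1,2), of n] m_x[of n] unfolding W_def by simp
  have W_X: "eventually (\<lambda>n. norm (W n - X n) \<le> ?d / 2 + \<eta>) U"
    using X_close
  proof eventually_elim
    case (elim n)
    then show ?case
      using resolvent_near_almost_fixed[OF R T l mK XK elim, of n] m_X[of n] unfolding W_def
      by linarith
  qed
  obtain V w\<^sub>0 where V: "V \<noteq> bot" "V \<le> U" and Ww: "weakly_tendsto W w\<^sub>0 V"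
    using weak_cluster_point[OF refl U(1), of W M] bound[OF WK] by blast
  \<comment> \<open>\<open>W n - X n\<close> tends weakly to \<open>w\<^sub>0 - p\<close>, so the bound for the former passes to the latter\<close>
  have w0: "norm (w\<^sub>0 - p) \<le> ?d / 2 + \<eta>"
  proof -
    have "eventually (\<lambda>n. W n - X n \<in> cball 0 (?d / 2 + \<eta>)) V"
      using filter_leD[OF V(2) W_X] by simp
    from weak_limit_in_closed_convex[OF weakly_tendsto_diff[OF Ww weakly_tendsto_mono[OF Xp V(2)]]
        V(1) convex_cball closed_cball this]
    show ?thesis by simp
  qed
  obtain N where N: "M' \<le> N" "norm ((x - p) - ?E N (x - p)) \<le> \<eta>"
      "norm ((w\<^sub>0 - p) - ?E N (w\<^sub>0 - p)) \<le> \<eta>"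
    using eventually_happens'[OF sequentially_bot
        eventually_conj[OF eventually_ge_at_top[of M'] eventually_conj[OF tail tail]]] by blast
  have "eventually (\<lambda>n. dist (?E N (W n)) (?E N w\<^sub>0) < \<eta>) V"
    using tendstoD[OF partial_sum_proj_weakly_tendsto[OF e Ww] \<eta>] .
  then have "\<exists>n. dist (?E N (W n)) (?E N w\<^sub>0) < \<eta> \<and> norm (?E N (X n - p)) \<le> \<eta>"
    using eventually_happens'[OF V(1) eventually_conj[OF _ filter_leD[OF V(2) E_X]]] by blast
  then obtain n where n: "norm (?E N (W n - w\<^sub>0)) < \<eta>" "norm (?E N (X n - p)) \<le> \<eta>"
    by (auto simp: dist_norm E_diff)
  have sum: "norm ((x - p) + (X n - p)) \<le> D * ?d + 4 * \<eta>"
  proof -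
    have "norm ((x - p) + (X n - p)) \<le> D * norm ((x - p) - (X n - p)) + 4 * \<eta>"
      by (rule norm_add_le_of_almost_disjoint[OF e N(2) n(2)])
    moreover have "D * norm (x - X n) \<le> D * ?d"
      using d[OF x(1) XK[of n]] D1 by (intro mult_left_mono) auto
    ultimately show ?thesis by simp
  qed
  have W_z: "norm (W n - z) \<le> D * ?d / 2 + 2 * \<eta>"
  proof -
    have "norm (W n - z) \<le> norm (m n - p)"
      unfolding W_def z_def by (rule resolvent_nonexpansive[OF R T l mK pK])
    also have "m n - p = (1 / 2) *\<^sub>R ((x - p) + (X n - p))"
      unfolding m_def by (simp add: algebra_simps flip: scaleR_left_distrib)
    finally show ?thesis using sum by simp
  qed
  \<comment> \<open>\<open>N\<close> was chosen past \<open>w\<^sub>0\<close>, so here \<open>E N\<close> costs no constant\<close>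
  have E_W: "norm (?E N (W n - p)) \<le> ?d / 2 + 3 * \<eta>"
  proof -
    have "?E N (W n - p) = ?E N (W n - w\<^sub>0) + - ((w\<^sub>0 - p) - ?E N (w\<^sub>0 - p)) + (w\<^sub>0 - p)"
      unfolding E_diff by simp
    then have "norm (?E N (W n - p)) \<le>
        norm (?E N (W n - w\<^sub>0)) + norm (- ((w\<^sub>0 - p) - ?E N (w\<^sub>0 - p))) + norm (w\<^sub>0 - p)"
      by (simp only: norm_add3_le)
    also have "\<dots> = norm (?E N (W n - w\<^sub>0)) + norm ((w\<^sub>0 - p) - ?E N (w\<^sub>0 - p)) + norm (w\<^sub>0 - p)"
      by (simp only: norm_minus_cancel)
    finally have "norm (?E N (W n - p)) \<le>
        norm (?E N (W n - w\<^sub>0)) + norm ((w\<^sub>0 - p) - ?E N (w\<^sub>0 - p)) + norm (w\<^sub>0 - p)" .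
    then show ?thesis using n(1) N(3) w0 by linarith
  qed
  have "2 * (?d - \<eta>) \<le> 2 * norm (W n - p)"
    unfolding W_def by (rule mult_left_mono[OF R_far[OF mK]]) simp
  also have "\<dots> \<le> norm (?E N (W n - p))
      + (1 + D) / 2 * (norm ((W n - p) - (x - p)) + norm ((W n - p) - (z - p))) + 3 * \<eta>"
    by (rule norm_le_of_three_close_points[OF e N(1) M' N(2) x(3)])
  also have "\<dots> \<le> (?d / 2 + 3 * \<eta>)
      + (1 + D) / 2 * ((?d / 2 + \<eta>) + (D * ?d / 2 + 2 * \<eta>)) + 3 * \<eta>"
    using E_W W_x[of n] W_z D1 by (intro add_mono mult_left_mono order_refl) auto
  finally have "2 * ?d \<le> (1 / 2 + (1 + D)\<^sup>2 / 4) * ?d + (8 + 3 / 2 * (1 + D)) * \<eta>"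
    by (simp add: field_simps power2_eq_square)
  also have "\<dots> \<le> (1 / 2 + (1 + D)\<^sup>2 / 4) * ?d + (8 + 3 * D) * \<eta>"
    using D1 \<eta> by (intro add_left_mono mult_right_mono) auto
  finally show ?thesis .
qed

theorem theorem3:
  fixes e :: "nat \<Rightarrow> 'a::banach" and D :: real
  assumes "reflexive_space TYPE('a)"
    and "D_unconditional_basis D e"
    and "D < sqrt 6 - 1"
  shows "fixed_point_property TYPE('a)"
  unfolding fixed_point_property_def
proof (intro allI impI)
  fix C :: "'a set" and T :: "'a \<Rightarrow> 'a"
  assume C: "C \<noteq> {}" "bounded C" "closed C" "convex C" "T \<in> C \<rightarrow> C" "nonexpansive_on C T"
  then obtain K where KC: "K \<subseteq> C" and K: "minimal_invariant_convex T K"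
    using minimal_invariant_convex_exists[OF assms(1), of T C] unfolding invariant_convex_def by auto
  have bK: "bounded K" and nK: "nonexpansive_on K T"
    using C(2,6) KC bounded_subset unfolding nonexpansive_on_def by blast+
  have D1: "1 \<le> D" by (rule unconditional_constant_ge_1[OF assms(2)])
  define c where "c = 2 - (1 / 2 + (1 + D)\<^sup>2 / 4)"
  have "(1 + D)\<^sup>2 < (sqrt 6)\<^sup>2"
    using assms(3) D1 by (intro power_strict_mono) auto
  then have c: "0 < c" unfolding c_def by simp
  have "c * diameter K \<le> 0 + \<delta>" if \<delta>: "0 < \<delta>" for \<delta>
  proof -
    have "0 < \<delta> / (8 + 3 * D)" and cancel: "(8 + 3 * D) * (\<delta> / (8 + 3 * D)) = \<delta>"
      using \<delta> D1 by simp_all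
    then have "2 * diameter K \<le> (1 / 2 + (1 + D)\<^sup>2 / 4) * diameter K + \<delta>"
      using diameter_minimal_invariant_bound[OF assms(1,2) K bK nK, of "\<delta> / (8 + 3 * D)"]
      unfolding cancel by blast
    then show ?thesis unfolding c_def left_diff_distrib by linarith
  qed
  then have "c * diameter K \<le> 0" by (rule field_le_epsilon)
  then have d: "diameter K \<le> 0" using c by (simp add: mult_le_0_iff)
  obtain x where x: "x \<in> K" "T x \<in> K"
    using K unfolding minimal_invariant_convex_def invariant_convex_def by blast
  have "dist (T x) x \<le> 0"
    using diameter_bounded_bound[OF bK x(2,1)] d by linarith
  then show "\<exists>x\<in>C. T x = x"
    using x(1) KC by auto
qed

end
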